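(* Determining an optimal (minimum-makespan) schedule for a single reclaimer, when the positions of the stockpiles are given and the stockpiles have to be reclaimed in a prespecified order, can be done in $O(n)$ time.
   Context: Reclaimer scheduling model. Two pads $P_1,P_2$ are each modeled as $[0,L]$, $L$ a positive integer; $n$ stockpiles, each on one pad, stockpile $j$ occupying a given interval $[l_j,r_j]\subseteq[0,L]$ with integers $l_j<r_j$, stockpiles on the same pad non-overlapping. Only reclaimer $R_0$ works; it moves on a rail represented by $[0,L]$, starting and ending at $0$. Reclaim speed $1$, travel speed $s\ge1$. Its schedule is a continuous piecewise linear $H_0:[0,C_0]\to[0,L]$, $H_0(0)=H_0(C_0)=0$, with pieces of slope $0$, $\pm s$ (travel) or $\pm1$ (reclaiming on either pad). Stockpile $j$ is reclaimed by traversing all of $[l_j,r_j]$ once at speed $1$ in either direction. The stockpiles are indexed so that they must be reclaimed in the order $1,2,\dots,n$ (reclaiming of $j+1$ starts after that of $j$ is finished). The objective is to minimize $C_0$. *)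

theory Defs
  imports Complex_Main "HOL-Library.Landau_Symbols"
begin

section \<open>Instances\<close>

datatype pad = P1 | P2

record stockpile =
  on_pad :: pad
  left :: int
  right :: int

text \<open>The list order of \<open>piles\<close> is the prescribed reclaiming order; stockpiles are numbered
  from 0.\<close>

record reclaim_instance =
  rail :: int
  speed :: real
  piles :: "stockpile list"

abbreviation num :: "reclaim_instance \<Rightarrow> nat" where
  "num I \<equiv> length (piles I)"

abbreviation lpos :: "reclaim_instance \<Rightarrow> nat \<Rightarrow> real" where
  "lpos I j \<equiv> real_of_int (left (piles I ! j))"

abbreviation rpos :: "reclaim_instance \<Rightarrow> nat \<Rightarrow> real" where
  "rpos I j \<equiv> real_of_int (right (piles I ! j))"

text \<open>Non-overlapping stockpiles may share an endpoint.\<close>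

definition valid_instance :: "reclaim_instance \<Rightarrow> bool" where
  "valid_instance I \<longleftrightarrow>
     rail I > 0 \<and> speed I \<ge> 1 \<and>
     (\<forall>p\<in>set (piles I). 0 \<le> left p \<and> left p < right p \<and> right p \<le> rail I) \<and>
     (\<forall>i<num I. \<forall>j<num I.
        i \<noteq> j \<and> on_pad (piles I ! i) = on_pad (piles I ! j) \<longrightarrow>
        right (piles I ! i) \<le> left (piles I ! j) \<or> right (piles I ! j) \<le> left (piles I ! i))"


section \<open>Schedules\<close>

text \<open>\<open>breakpoints m \<tau> C\<close>: \<open>0 = \<tau> 0 \<le> \<dots> \<le> \<tau> m = C\<close>. Pieces of length zero are permitted and
  impose no condition.\<close>

definition breakpoints :: "nat \<Rightarrow> (nat \<Rightarrow> real) \<Rightarrow> real \<Rightarrow> bool" where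
  "breakpoints m \<tau> C \<longleftrightarrow> \<tau> 0 = 0 \<and> \<tau> m = C \<and> (\<forall>i<m. \<tau> i \<le> \<tau> (Suc i))"

definition linear_piece :: "(real \<Rightarrow> real) \<Rightarrow> real \<Rightarrow> real \<Rightarrow> real \<Rightarrow> bool" where
  "linear_piece H a b v \<longleftrightarrow> (\<forall>t\<in>{a..b}. H t = H a + v * (t - a))"

definition reclaim_end :: "reclaim_instance \<Rightarrow> (nat \<Rightarrow> real) \<Rightarrow> nat \<Rightarrow> real" where
  "reclaim_end I S j = S j + (rpos I j - lpos I j)"

text \<open>\<open>H\<close> is the reclaimer's position on \<open>{0..C}\<close> (its values elsewhere are irrelevant), and
  \<open>S j\<close> is the time at which reclaiming of stockpile \<open>j\<close> starts. If \<open>s > 1\<close>, then slope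
  \<open>1\<close> or \<open>-1\<close> is possible only while reclaiming.\<close>

definition schedule ::
    "reclaim_instance \<Rightarrow> real \<Rightarrow> (real \<Rightarrow> real) \<Rightarrow> (nat \<Rightarrow> real) \<Rightarrow> bool" where
  "schedule I C H S \<longleftrightarrow>
     0 \<le> C \<and> H 0 = 0 \<and> H C = 0 \<and>
     H ` {0..C} \<subseteq> {0..real_of_int (rail I)} \<and>
     continuous_on {0..C} H \<and>
     (\<exists>m \<tau>. breakpoints m \<tau> C \<and>
        (\<forall>i<m. \<exists>v. linear_piece H (\<tau> i) (\<tau> (Suc i)) v \<and>
           (v \<in> {0, speed I, - speed I} \<or>
            v \<in> {1, - 1} \<and>
              (\<exists>j<num I. S j \<le> \<tau> i \<and> \<tau> (Suc i) \<le> reclaim_end I S j)))) \<and>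
     (\<forall>j<num I. 0 \<le> S j \<and> reclaim_end I S j \<le> C \<and>
        ((\<forall>t\<in>{S j..reclaim_end I S j}. H t = lpos I j + (t - S j)) \<or>
         (\<forall>t\<in>{S j..reclaim_end I S j}. H t = rpos I j - (t - S j)))) \<and>
     (\<forall>j. Suc j < num I \<longrightarrow> reclaim_end I S j \<le> S (Suc j))"

definition optimal_schedule ::
    "reclaim_instance \<Rightarrow> real \<Rightarrow> (real \<Rightarrow> real) \<Rightarrow> (nat \<Rightarrow> real) \<Rightarrow> bool" where
  "optimal_schedule I C H S \<longleftrightarrow>
     schedule I C H S \<and> (\<forall>C' H' S'. schedule I C' H' S' \<longrightarrow> C \<le> C')"


section \<open>Model of computation\<close>

text \<open>A real RAM, as a while language: every arithmetic operation, comparison, memory access and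
  assignment costs one unit. There is no conversion between reals and indices (in particular no
  rounding), real constants are integers, and index arithmetic is limited to successor and
  predecessor. Total operations follow HOL: the predecessor of 0 is 0 and division by 0 gives 0.\<close>

type_synonym name = string

record state =
  ivar :: "name \<Rightarrow> nat"
  rvar :: "name \<Rightarrow> real"
  arr :: "name \<Rightarrow> nat \<Rightarrow> real"

datatype iexp = IConst nat | IVar name | ISuc iexp | IPred iexp

datatype rop = Plus | Minus | Times | Divide

datatype rexp = RConst int | RVar name | RGet name iexp | ROp rop rexp rexp

datatype bexp = ILess iexp iexp | RLess rexp rexp | BNot bexp | BAnd bexp bexp

datatype com =
    Skip
  | IAssign name iexp
  | RAssign name rexp
  | RPut name iexp rexp
  | Seq com com
  | Cond bexp com com
  | While bexp com

fun ival :: "iexp \<Rightarrow> state \<Rightarrow> nat" where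
  "ival (IConst k) \<sigma> = k"
| "ival (IVar x) \<sigma> = ivar \<sigma> x"
| "ival (ISuc e) \<sigma> = Suc (ival e \<sigma>)"
| "ival (IPred e) \<sigma> = ival e \<sigma> - 1"

fun rop_val :: "rop \<Rightarrow> real \<Rightarrow> real \<Rightarrow> real" where
  "rop_val Plus x y = x + y"
| "rop_val Minus x y = x - y"
| "rop_val Times x y = x * y"
| "rop_val Divide x y = x / y"

fun rval :: "rexp \<Rightarrow> state \<Rightarrow> real" where
  "rval (RConst k) \<sigma> = real_of_int k"
| "rval (RVar x) \<sigma> = rvar \<sigma> x"
| "rval (RGet A e) \<sigma> = arr \<sigma> A (ival e \<sigma>)"
| "rval (ROp f e1 e2) \<sigma> = rop_val f (rval e1 \<sigma>) (rval e2 \<sigma>)"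

fun bval :: "bexp \<Rightarrow> state \<Rightarrow> bool" where
  "bval (ILess e1 e2) \<sigma> \<longleftrightarrow> ival e1 \<sigma> < ival e2 \<sigma>"
| "bval (RLess e1 e2) \<sigma> \<longleftrightarrow> rval e1 \<sigma> < rval e2 \<sigma>"
| "bval (BNot b) \<sigma> \<longleftrightarrow> \<not> bval b \<sigma>"
| "bval (BAnd b1 b2) \<sigma> \<longleftrightarrow> bval b1 \<sigma> \<and> bval b2 \<sigma>"

fun icost :: "iexp \<Rightarrow> nat" where
  "icost (IConst k) = 1"
| "icost (IVar x) = 1"
| "icost (ISuc e) = icost e + 1"
| "icost (IPred e) = icost e + 1"

fun rcost :: "rexp \<Rightarrow> nat" where
  "rcost (RConst k) = 1"
| "rcost (RVar x) = 1"
| "rcost (RGet A e) = icost e + 1"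
| "rcost (ROp f e1 e2) = rcost e1 + rcost e2 + 1"

fun bcost :: "bexp \<Rightarrow> nat" where
  "bcost (ILess e1 e2) = icost e1 + icost e2 + 1"
| "bcost (RLess e1 e2) = rcost e1 + rcost e2 + 1"
| "bcost (BNot b) = bcost b + 1"
| "bcost (BAnd b1 b2) = bcost b1 + bcost b2 + 1"

text \<open>\<open>exec c \<sigma> t \<sigma>'\<close>: started in \<open>\<sigma>\<close>, \<open>c\<close> halts in \<open>\<sigma>'\<close> at total cost \<open>t\<close>.\<close>

inductive exec :: "com \<Rightarrow> state \<Rightarrow> nat \<Rightarrow> state \<Rightarrow> bool" where
  Skip: "exec Skip \<sigma> 1 \<sigma>"
| IAssign: "exec (IAssign x e) \<sigma> (icost e + 1) (\<sigma>\<lparr>ivar := (ivar \<sigma>)(x := ival e \<sigma>)\<rparr>)"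
| RAssign: "exec (RAssign x e) \<sigma> (rcost e + 1) (\<sigma>\<lparr>rvar := (rvar \<sigma>)(x := rval e \<sigma>)\<rparr>)"
| RPut: "exec (RPut A k e) \<sigma> (icost k + rcost e + 1)
    (\<sigma>\<lparr>arr := (arr \<sigma>)(A := (arr \<sigma> A)(ival k \<sigma> := rval e \<sigma>))\<rparr>)"
| Seq: "exec c1 \<sigma> t1 \<sigma>1 \<Longrightarrow> exec c2 \<sigma>1 t2 \<sigma>2 \<Longrightarrow> exec (Seq c1 c2) \<sigma> (t1 + t2) \<sigma>2"
| CondTrue: "bval b \<sigma> \<Longrightarrow> exec c1 \<sigma> t \<sigma>1 \<Longrightarrow> exec (Cond b c1 c2) \<sigma> (bcost b + t + 1) \<sigma>1"
| CondFalse: "\<not> bval b \<sigma> \<Longrightarrow> exec c2 \<sigma> t \<sigma>1 \<Longrightarrow> exec (Cond b c1 c2) \<sigma> (bcost b + t + 1) \<sigma>1"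
| WhileFalse: "\<not> bval b \<sigma> \<Longrightarrow> exec (While b c) \<sigma> (bcost b + 1) \<sigma>"
| WhileTrue: "bval b \<sigma> \<Longrightarrow> exec c \<sigma> t1 \<sigma>1 \<Longrightarrow> exec (While b c) \<sigma>1 t2 \<sigma>2 \<Longrightarrow>
    exec (While b c) \<sigma> (bcost b + t1 + t2 + 1) \<sigma>2"

inductive_cases SkipE: "exec Skip \<sigma> t \<sigma>'"
  and IAssignE: "exec (IAssign x e) \<sigma> t \<sigma>'"
  and RAssignE: "exec (RAssign x e) \<sigma> t \<sigma>'"
  and RPutE: "exec (RPut A k e) \<sigma> t \<sigma>'"
  and SeqE: "exec (Seq c1 c2) \<sigma> t \<sigma>'"
  and CondE: "exec (Cond b c1 c2) \<sigma> t \<sigma>'"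
  and WhileE: "exec (While b c) \<sigma> t \<sigma>'"

lemma exec_deterministic:
  "exec c \<sigma> t \<sigma>1 \<Longrightarrow> exec c \<sigma> u \<sigma>2 \<Longrightarrow> t = u \<and> \<sigma>1 = \<sigma>2"
proof (induction arbitrary: u \<sigma>2 rule: exec.induct)
  case (Skip \<sigma>)
  from Skip.prems show ?case by (rule SkipE) simp
next
  case (IAssign x e \<sigma>)
  from IAssign.prems show ?case by (rule IAssignE) simp
next
  case (RAssign x e \<sigma>)
  from RAssign.prems show ?case by (rule RAssignE) simp
next
  case (RPut A k e \<sigma>)
  from RPut.prems show ?case by (rule RPutE) simp
next
  case (Seq c1 \<sigma> t1 \<sigma>1 c2 t2 \<sigma>')
  from Seq.prems show ?case
  proof (rule SeqE)
    fix u1 \<rho> u2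
    assume u: "u = u1 + u2" and 1: "exec c1 \<sigma> u1 \<rho>" and 2: "exec c2 \<rho> u2 \<sigma>2"
    from Seq.IH(1)[OF 1] have "t1 = u1" "\<sigma>1 = \<rho>" by simp_all
    with Seq.IH(2)[of u2 \<sigma>2] 2 u show ?thesis by simp
  qed
next
  case (CondTrue b \<sigma> c1 t \<sigma>1 c2)
  from CondTrue.prems show ?case
  proof (rule CondE)
    fix u1 assume u: "u = Suc (bcost b + u1)" and 1: "exec c1 \<sigma> u1 \<sigma>2"
    from CondTrue.IH[OF 1] u show ?thesis by simp
  qed (use CondTrue.hyps(1) in simp)
next
  case (CondFalse b \<sigma> c2 t \<sigma>1 c1)
  from CondFalse.prems show ?case
  proof (rule CondE)
    fix u1 assume u: "u = Suc (bcost b + u1)" and 1: "exec c2 \<sigma> u1 \<sigma>2"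
    from CondFalse.IH[OF 1] u show ?thesis by simp
  qed (use CondFalse.hyps(1) in simp)
next
  case (WhileFalse b \<sigma> c)
  from WhileFalse.prems show ?case
    by (rule WhileE) (use WhileFalse.hyps(1) in simp_all)
next
  case (WhileTrue b \<sigma> c t1 \<sigma>1 t2 \<sigma>')
  from WhileTrue.prems show ?case
  proof (rule WhileE)
    fix u1 \<rho> u2
    assume u: "u = Suc (bcost b + u1 + u2)" and 1: "exec c \<sigma> u1 \<rho>"
      and 2: "exec (While b c) \<rho> u2 \<sigma>2"
    from WhileTrue.IH(1)[OF 1] have "t1 = u1" "\<sigma>1 = \<rho>" by simp_all
    with WhileTrue.IH(2)[of u2 \<sigma>2] 2 u show ?thesis by simp
  qed (use WhileTrue.hyps(1) in simp)
qed


section \<open>Input and output\<close>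

fun pad_number :: "pad \<Rightarrow> real" where
  "pad_number P1 = 1"
| "pad_number P2 = 2"

definition input_state :: "reclaim_instance \<Rightarrow> state" where
  "input_state I =
     \<lparr>ivar = (\<lambda>_. 0)(''n'' := num I),
      rvar = (\<lambda>_. 0)(''L'' := real_of_int (rail I), ''s'' := speed I),
      arr = (\<lambda>_ _. 0)
        (''pad'' := (\<lambda>j. if j < num I then pad_number (on_pad (piles I ! j)) else 0),
         ''l'' := (\<lambda>j. if j < num I then lpos I j else 0),
         ''r'' := (\<lambda>j. if j < num I then rpos I j else 0))\<rparr>"

text \<open>A schedule is written out as its makespan, the polyline through the points
  \<open>(time i, pos i)\<close>, \<open>i \<le> m\<close>, and the starting times of the reclaiming operations.\<close>

definition output_schedule ::
    "state \<Rightarrow> real \<Rightarrow> (real \<Rightarrow> real) \<Rightarrow> (nat \<Rightarrow> real) \<Rightarrow> bool" where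
  "output_schedule \<sigma> C H S \<longleftrightarrow>
     (let m = ivar \<sigma> ''m''; \<tau> = arr \<sigma> ''time''; x = arr \<sigma> ''pos'' in
      rvar \<sigma> ''C'' = C \<and> arr \<sigma> ''start'' = S \<and>
      breakpoints m \<tau> C \<and>
      (\<forall>i\<le>m. H (\<tau> i) = x i) \<and>
      (\<forall>i<m. \<exists>v. linear_piece H (\<tau> i) (\<tau> (Suc i)) v))"

definition computes_optimal_schedule_within :: "com \<Rightarrow> (nat \<Rightarrow> nat) \<Rightarrow> bool" where
  "computes_optimal_schedule_within prog T \<longleftrightarrow>
     (\<forall>I. valid_instance I \<longrightarrow>
        (\<exists>t \<sigma>. exec prog (input_state I) t \<sigma> \<and> t \<le> T (num I) \<and>
           (\<exists>C H S. output_schedule \<sigma> C H S \<and> optimal_schedule I C H S)))"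

end

theory Submission
  imports Defs
begin

text \<open>Travel costs distance divided by \<open>s\<close> and only the two reclaiming directions of each stockpile
  matter, so the least time still needed from position \<open>p\<close> with a suffix of the stockpiles left is
  given by a two-way recursion. A backward pass tabulates it at the two ends of every stockpile; a
  forward pass then follows the minimising choices and writes down the trajectory. Optimality
  holds because every feasible trajectory is \<open>s\<close>-Lipschitz. A fictitious stockpile of width \<open>0\<close> at
  position \<open>0\<close> with index \<open>n\<close>, which the zero-initialised arrays provide for free, makes the
  return trip an ordinary step.\<close>

section \<open>The recursion and the lower bound\<close>

fun remaining_time :: "real \<Rightarrow> stockpile list \<Rightarrow> real \<Rightarrow> real" where
  "remaining_time s [] p = \<bar>p\<bar> / s"
| "remaining_time s (q # qs) p =
     min (\<bar>p - real_of_int (left q)\<bar> / s + remaining_time s qs (real_of_int (right q)))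
         (\<bar>p - real_of_int (right q)\<bar> / s + remaining_time s qs (real_of_int (left q)))
     + (real_of_int (right q) - real_of_int (left q))"

text \<open>Like \<open>rend\<close>, the exact contents of an input array on all indices; the value
  0 at index \<open>num I\<close> is an end of the fictitious stockpile.\<close>

definition lend :: "reclaim_instance \<Rightarrow> nat \<Rightarrow> real" where
  "lend I = (\<lambda>j. if j < num I then lpos I j else 0)"

definition rend :: "reclaim_instance \<Rightarrow> nat \<Rightarrow> real" where
  "rend I = (\<lambda>j. if j < num I then rpos I j else 0)"

text \<open>At \<open>k = num I\<close> both suffixes are empty and both ends are 0, so either
  branch of the minimum is \<open>\<bar>p\<bar> / s\<close>: the return trip obeys the same
  recursion as a real stockpile.\<close>

lemma remaining_time_drop:
  assumes "k \<le> num I"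
  shows "remaining_time s (drop k (piles I)) p =
    min (\<bar>p - lend I k\<bar> / s + remaining_time s (drop (Suc k) (piles I)) (rend I k))
        (\<bar>p - rend I k\<bar> / s + remaining_time s (drop (Suc k) (piles I)) (lend I k))
    + (rend I k - lend I k)"
proof (cases "k < num I")
  case True
  then show ?thesis
    by (simp add: Cons_nth_drop_Suc[symmetric] lend_def rend_def)
next
  case False
  with assms show ?thesis by (simp add: lend_def rend_def)
qed

section \<open>Speed bound on trajectories\<close>

lemma linear_pieceD:
  "linear_piece H a b v \<Longrightarrow> a \<le> t \<Longrightarrow> t \<le> b \<Longrightarrow> H t = H a + v * (t - a)"
  unfolding linear_piece_def by (meson atLeastAtMost_iff)

text \<open>Induction over the breakpoints: two times inside one piece are settled by its slope; if
  they straddle a breakpoint, the interval is split there and the two bounds add up.\<close>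

lemma piecewise_linear_lipschitz:
  assumes \<tau>: "breakpoints m \<tau> C"
    and pieces: "\<And>i. i < m \<Longrightarrow> \<exists>v. linear_piece H (\<tau> i) (\<tau> (Suc i)) v \<and> \<bar>v\<bar> \<le> s"
    and tu: "0 \<le> t" "t \<le> u" "u \<le> C"
  shows "\<bar>H u - H t\<bar> \<le> s * (u - t)"
proof -
  have step: "\<bar>H u - H t\<bar> \<le> s * (u - t)"
    if "i < m" "\<tau> i \<le> t" "t \<le> u" "u \<le> \<tau> (Suc i)" for i t u
  proof -
    from pieces[OF that(1)] obtain v where
      v: "linear_piece H (\<tau> i) (\<tau> (Suc i)) v" "\<bar>v\<bar> \<le> s" by blast
    have "H t = H (\<tau> i) + v * (t - \<tau> i)" "H u = H (\<tau> i) + v * (u - \<tau> i)"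
      by (rule linear_pieceD[OF v(1)]; use that in simp)+
    then have "H u - H t = v * (u - t)" by (simp add: algebra_simps)
    then have "\<bar>H u - H t\<bar> = \<bar>v\<bar> * (u - t)" using that by (simp add: abs_mult)
    also have "\<dots> \<le> s * (u - t)" using v that by (intro mult_right_mono) auto
    finally show ?thesis .
  qed
  have "\<forall>t u. 0 \<le> t \<longrightarrow> t \<le> u \<longrightarrow> u \<le> \<tau> i \<longrightarrow> \<bar>H u - H t\<bar> \<le> s * (u - t)" if "i \<le> m" for i
    using that
  proof (induction i)
    case 0
    have "\<tau> 0 = 0" using \<tau> by (simp add: breakpoints_def)
    then have "t = u" if "0 \<le> t" "t \<le> u" "u \<le> \<tau> 0" for t u using that by linarith
    then show ?case by force
  next
    case (Suc i)
    show ?case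
    proof (intro allI impI)
      fix t u assume tu: "0 \<le> t" "t \<le> u" "u \<le> \<tau> (Suc i)"
      have IH: "\<bar>H b - H a\<bar> \<le> s * (b - a)" if "0 \<le> a" "a \<le> b" "b \<le> \<tau> i" for a b
        using Suc that by simp
      consider "u \<le> \<tau> i" | "\<tau> i \<le> t" | "t \<le> \<tau> i" "\<tau> i \<le> u" by linarith
      then show "\<bar>H u - H t\<bar> \<le> s * (u - t)"
      proof cases
        case 1
        show ?thesis using IH[OF tu(1,2) 1] .
      next
        case 2
        show ?thesis using step[OF _ 2 tu(2,3)] Suc.prems by simp
      next
        case 3
        then have "\<bar>H u - H (\<tau> i)\<bar> \<le> s * (u - \<tau> i)" "\<bar>H (\<tau> i) - H t\<bar> \<le> s * (\<tau> i - t)"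
          using step[of i "\<tau> i" u] IH[of t "\<tau> i"] tu Suc.prems by auto
        moreover have "s * (u - t) = s * (u - \<tau> i) + s * (\<tau> i - t)"
          by (simp add: algebra_simps)
        ultimately show ?thesis by linarith
      qed
    qed
  qed
  moreover have "\<tau> m = C" using \<tau> by (simp add: breakpoints_def)
  ultimately show ?thesis using tu by blast
qed

text \<open>The reclaiming slopes 1 and -1 are also bounded by \<open>speed I\<close>, which is at
  least 1. Dividing by the speed tells how long a displacement must take.\<close>

lemma schedule_lipschitz:
  assumes "schedule I C H S" "1 \<le> speed I" "0 \<le> t" "t \<le> u" "u \<le> C"
  shows "\<bar>H u - H t\<bar> / speed I \<le> u - t"
proof -
  obtain m \<tau> where "breakpoints m \<tau> C"
    and "\<forall>i<m. \<exists>v. linear_piece H (\<tau> i) (\<tau> (Suc i)) v \<and>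
           (v \<in> {0, speed I, - speed I} \<or>
            v \<in> {1, - 1} \<and> (\<exists>j<num I. S j \<le> \<tau> i \<and> \<tau> (Suc i) \<le> reclaim_end I S j))"
    using assms(1) unfolding schedule_def by blast
  moreover have "\<bar>v\<bar> \<le> speed I" if "v \<in> {0, speed I, - speed I} \<or> v \<in> {1, - 1}" for v
    using that assms(2) by auto
  ultimately have "\<bar>H u - H t\<bar> \<le> speed I * (u - t)"
    using assms(3-) by (intro piecewise_linear_lipschitz[of m \<tau> C]) blast+
  then show ?thesis using assms(2) by (simp add: divide_le_eq mult.commute)
qed

section \<open>Lower bound for an arbitrary schedule\<close>

text \<open>Downward induction on \<open>k\<close>, with \<open>t\<close> any moment up to the start
  of stockpile \<open>k\<close>. Reaching \<open>H (S k)\<close> takes at least distance over speed,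
  reclaiming takes the width, and the induction hypothesis covers the rest; after the last stockpile
  only the return to \<open>H C = 0\<close> remains.\<close>

lemma schedule_remaining_time:
  assumes sch: "schedule I C H S" and s: "1 \<le> speed I"
    and wd: "\<And>j. j < num I \<Longrightarrow> lpos I j \<le> rpos I j"
    and "k \<le> num I" "0 \<le> t" "t \<le> C" "k < num I \<Longrightarrow> t \<le> S k"
  shows "remaining_time (speed I) (drop k (piles I)) (H t) \<le> C - t"
  using assms(4-)
proof (induction k arbitrary: t rule: inc_induct)
  case base
  have "H C = 0" using sch by (simp add: schedule_def)
  then show ?case using schedule_lipschitz[OF sch s, of t C] base by simp
next
  case (step k)
  let ?e = "reclaim_end I S k"
  note k = \<open>k < num I\<close>
  have "0 \<le> S k \<and> ?e \<le> C \<and>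
      ((\<forall>t\<in>{S k..?e}. H t = lpos I k + (t - S k)) \<or>
       (\<forall>t\<in>{S k..?e}. H t = rpos I k - (t - S k)))"
    using sch k unfolding schedule_def by blast
  moreover have "S k \<le> ?e" "t \<le> S k"
    using wd[OF k] step.prems k by (auto simp: reclaim_end_def)
  ultimately have S: "0 \<le> S k" "?e \<le> C" "S k \<le> ?e" "t \<le> S k"
    and dir: "(\<forall>t\<in>{S k..?e}. H t = lpos I k + (t - S k)) \<or>
              (\<forall>t\<in>{S k..?e}. H t = rpos I k - (t - S k))"
    by blast+
  \<comment> \<open>The prescribed order admits the end of reclaiming \<open>k\<close> as the moment
    \<open>t\<close> of the induction hypothesis.\<close>
  have "Suc k < num I \<Longrightarrow> ?e \<le> S (Suc k)" using sch by (simp add: schedule_def)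
  then have rest: "remaining_time (speed I) (drop (Suc k) (piles I)) (H ?e) \<le> C - ?e"
    using S by (intro step.IH) auto
  have trip: "\<bar>H t - H (S k)\<bar> / speed I \<le> S k - t"
    using schedule_lipschitz[OF sch s, of t "S k"] S step.prems by (simp add: abs_minus_commute)
  have e: "?e = S k + (rpos I k - lpos I k)" by (simp add: reclaim_end_def)
  \<comment> \<open>Reclaiming ends opposite to where it began, so the schedule follows one of the
    two arguments of the minimum.\<close>
  have "H (S k) = lpos I k \<and> H ?e = rpos I k \<or> H (S k) = rpos I k \<and> H ?e = lpos I k"
    using dir S(3) by (auto simp: e)
  then show ?case
    using rest trip e k
    by (auto simp: remaining_time_drop[of k] lend_def rend_def min_def)
qed

corollary schedule_lower_bound:
  assumes "schedule I C H S" "valid_instance I"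
  shows "remaining_time (speed I) (piles I) 0 \<le> C"
proof -
  have "lpos I j \<le> rpos I j" if "j < num I" for j
    using assms(2) nth_mem[OF that] by (force simp: valid_instance_def)
  moreover have "H 0 = 0" "0 \<le> C" "0 < num I \<Longrightarrow> 0 \<le> S 0" "1 \<le> speed I"
    using assms by (auto simp: schedule_def valid_instance_def)
  ultimately show ?thesis
    using schedule_remaining_time[OF assms(1), of 0 0] by simp
qed


section \<open>From a tour to a schedule\<close>

lemma breakpoints_mono:
  assumes "breakpoints m \<tau> C" "i \<le> j" "j \<le> m"
  shows "\<tau> i \<le> \<tau> j"
  using assms(2,3)
proof (induction rule: dec_induct)
  case (step k)
  then have "\<tau> i \<le> \<tau> k" "\<tau> k \<le> \<tau> (Suc k)" using assms(1) by (simp_all add: breakpoints_def)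
  then show ?case by simp
qed simp

lemma linear_piece_cong:
  assumes "\<And>t. a \<le> t \<Longrightarrow> t \<le> b \<Longrightarrow> G t = H t" "a \<le> b"
  shows "linear_piece G a b v \<longleftrightarrow> linear_piece H a b v"
proof -
  have "G a = H a" using assms by simp
  then show ?thesis
    unfolding linear_piece_def by (intro ball_cong refl) (simp add: assms(1))
qed

text \<open>A linear piece is monotone, so its values lie between its end values; this keeps the
  polyline on the rail.\<close>

lemma linear_piece_segment:
  assumes "linear_piece H a b v" "H a \<in> {c..d}" "H b \<in> {c..d}" "a \<le> t" "t \<le> b"
  shows "H t \<in> {c..d}"
proof -
  have t: "H t = H a + v * (t - a)" and b: "H b = H a + v * (b - a)"
    by (rule linear_pieceD[OF assms(1)]; use assms(4,5) in simp)+
  show ?thesis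
  proof (cases "0 \<le> v")
    case True
    then have "0 \<le> v * (t - a)" "v * (t - a) \<le> v * (b - a)"
      using assms by (auto intro: mult_left_mono)
    then show ?thesis using t b assms by auto
  next
    case False
    then have "v * (t - a) \<le> 0" "v * (b - a) \<le> v * (t - a)"
      using assms by (auto intro: mult_left_mono_neg mult_nonpos_nonneg)
    then show ?thesis using t b assms by auto
  qed
qed

text \<open>Pieces are glued on one at a time, with \<open>C\<close> generalised because a prefix
  ends at \<open>\<tau> m\<close>. The second hypothesis excludes jumps: over a piece of length zero
  it forces \<open>x (Suc i) = x i\<close>.\<close>

lemma polyline_exists:
  fixes \<tau> x v :: "nat \<Rightarrow> real"
  assumes "breakpoints m \<tau> C"
    and "\<And>i. i < m \<Longrightarrow> x (Suc i) = x i + v i * (\<tau> (Suc i) - \<tau> i)"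
    and "\<And>i. i \<le> m \<Longrightarrow> x i \<in> {c..d}"
  shows "\<exists>H. (\<forall>i\<le>m. H (\<tau> i) = x i) \<and> (\<forall>i<m. linear_piece H (\<tau> i) (\<tau> (Suc i)) (v i)) \<and>
    continuous_on {0..C} H \<and> H ` {0..C} \<subseteq> {c..d}"
  using assms
proof (induction m arbitrary: C)
  case 0
  then have "\<tau> 0 = 0" "C = 0" by (auto simp: breakpoints_def)
  with 0 show ?case by (intro exI[of _ "\<lambda>_. x 0"]) auto
next
  case (Suc m)
  let ?T = "\<tau> m" and ?U = "\<tau> (Suc m)"
  have b: "breakpoints m \<tau> ?T" and TU: "?T \<le> ?U" and C: "C = ?U"
    using Suc.prems(1) by (auto simp: breakpoints_def)
  have "0 \<le> ?T" using breakpoints_mono[OF b, of 0 m] b by (simp add: breakpoints_def)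
  from Suc.IH[OF b] Suc.prems obtain G where
    G: "\<forall>i\<le>m. G (\<tau> i) = x i" "\<forall>i<m. linear_piece G (\<tau> i) (\<tau> (Suc i)) (v i)"
       "continuous_on {0..?T} G" "G ` {0..?T} \<subseteq> {c..d}" by force
  \<comment> \<open>Since \<open>G\<close> takes the value \<open>x m\<close> at
    \<open>\<tau> m\<close>, the two formulas agree there, and continuity follows on the union of
    two closed intervals.\<close>
  define H where "H = (\<lambda>t. if t \<le> ?T then G t else x m + v m * (t - ?T))"
  have HG: "H t = G t" if "t \<le> ?T" for t using that by (simp add: H_def)
  have H_last: "H t = x m + v m * (t - ?T)" if "?T \<le> t" for t
    using that G(1) by (cases "t = ?T") (auto simp: H_def)
  have vals: "H (\<tau> i) = x i" if "i \<le> Suc m" for i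
  proof (cases "i = Suc m")
    case True
    then show ?thesis using H_last[OF TU] Suc.prems(2)[of m] by simp
  next
    case False
    then show ?thesis using that G(1) HG breakpoints_mono[OF b, of i m] by auto
  qed
  have last: "linear_piece H ?T ?U (v m)"
    by (auto simp: linear_piece_def H_last)
  have pieces: "linear_piece H (\<tau> i) (\<tau> (Suc i)) (v i)" if "i < Suc m" for i
  proof (cases "i = m")
    case False
    with that have "\<tau> i \<le> \<tau> (Suc i)" "\<tau> (Suc i) \<le> ?T"
      using b breakpoints_mono[OF b, of "Suc i" m] by (auto simp: breakpoints_def)
    then have "linear_piece H (\<tau> i) (\<tau> (Suc i)) (v i) \<longleftrightarrow> linear_piece G (\<tau> i) (\<tau> (Suc i)) (v i)"
      by (intro linear_piece_cong HG) auto
    then show ?thesis using G(2) that False by auto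
  qed (use last in simp)
  have union: "{0..C} = {0..?T} \<union> {?T..?U}" using C TU \<open>0 \<le> ?T\<close> by auto
  have "continuous_on {0..?T} H" using G(3) HG by (subst continuous_on_cong[of _ _ H G]) auto
  moreover have "continuous_on {?T..?U} H"
    by (subst continuous_on_cong[OF refl, of _ H "\<lambda>t. x m + v m * (t - ?T)"])
       (auto simp: H_last intro!: continuous_intros)
  ultimately have "continuous_on {0..C} H"
    unfolding union by (intro continuous_on_closed_Un) auto
  moreover have "H t \<in> {c..d}" if t: "t \<in> {0..C}" for t
  proof (cases "t \<le> ?T")
    case True
    then have "G t \<in> {c..d}" using G(4) t image_subset_iff[of G "{0..?T}"] by simp
    then show ?thesis using HG True by simp
  next
    case False
    then show ?thesis
      using linear_piece_segment[OF last, of c d t] vals[of m] vals[of "Suc m"]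
        Suc.prems(3)[of m] Suc.prems(3)[of "Suc m"] t C by auto
  qed
  ultimately show ?case using vals pieces by (intro exI[of _ H]) auto
qed

section \<open>Tours as alternating travel and reclaiming\<close>

text \<open>Points \<open>2 * k + 1\<close> and \<open>2 * k + 2\<close> of the polyline are the beginning and the end of the
  reclaiming of stockpile \<open>k\<close>; stockpile \<open>n\<close> is the fictitious one.\<close>

definition tour ::
    "reclaim_instance \<Rightarrow> nat \<Rightarrow> (nat \<Rightarrow> real) \<Rightarrow> (nat \<Rightarrow> real) \<Rightarrow> (nat \<Rightarrow> real) \<Rightarrow> bool" where
  "tour I N \<tau> x S \<longleftrightarrow> \<tau> 0 = 0 \<and> x 0 = 0 \<and>
     (\<forall>k<N. (x (2*k+1) = lend I k \<and> x (2*k+2) = rend I k \<or>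
             x (2*k+1) = rend I k \<and> x (2*k+2) = lend I k) \<and>
        \<tau> (2*k+1) = \<tau> (2*k) + \<bar>x (2*k) - x (2*k+1)\<bar> / speed I \<and>
        \<tau> (2*k+2) = \<tau> (2*k+1) + (rend I k - lend I k) \<and>
        S k = \<tau> (2*k+1))"

text \<open>Even-numbered pieces are travel and odd-numbered ones reclaiming, so interpolating with
  these slopes gives a schedule; the visit to the fictitious stockpile brings the reclaimer back to
  0.\<close>

lemma tour_schedule:
  fixes I \<tau> x S
  defines "m \<equiv> 2 * Suc (num I)"
  assumes valid: "valid_instance I" and tour: "tour I (Suc (num I)) \<tau> x S"
  shows "\<exists>H. breakpoints m \<tau> (\<tau> m) \<and> (\<forall>i\<le>m. H (\<tau> i) = x i) \<and>
    (\<forall>i<m. \<exists>v. linear_piece H (\<tau> i) (\<tau> (Suc i)) v) \<and> schedule I (\<tau> m) H S"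
proof -
  let ?s = "speed I"
  have s: "1 \<le> ?s" using valid by (simp add: valid_instance_def)
  have pile: "0 \<le> lpos I k" "lpos I k < rpos I k" "rpos I k \<le> real_of_int (rail I)"
    if "k < num I" for k
    using valid nth_mem[OF that] by (force simp: valid_instance_def)+
  have ends: "0 \<le> lend I k" "lend I k \<le> rend I k" "rend I k \<le> real_of_int (rail I)" for k
    using pile[of k] pile(2)[of k, THEN less_imp_le] valid
    by (cases "k < num I"; simp add: lend_def rend_def valid_instance_def)+
  have init: "\<tau> 0 = 0" "x 0 = 0"
    and dir: "k \<le> num I \<Longrightarrow> x (2*k+1) = lend I k \<and> x (2*k+2) = rend I k \<or>
             x (2*k+1) = rend I k \<and> x (2*k+2) = lend I k"
    and travel: "k \<le> num I \<Longrightarrow> \<tau> (2*k+1) = \<tau> (2*k) + \<bar>x (2*k) - x (2*k+1)\<bar> / ?s"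
    and reclaim: "k \<le> num I \<Longrightarrow> \<tau> (2*k+2) = \<tau> (2*k+1) + (rend I k - lend I k)"
    and start: "k \<le> num I \<Longrightarrow> S k = \<tau> (2*k+1)" for k
    using tour by (auto simp: tour_def less_Suc_eq_le)
  have parity: "\<exists>k\<le>num I. i = 2*k \<or> i = 2*k+1" if "i < m" for i
    using that unfolding m_def by presburger
  have mono: "\<tau> i \<le> \<tau> (Suc i)" if "i < m" for i
    using parity[OF that] travel reclaim ends s by auto
  then have bp: "breakpoints m \<tau> (\<tau> m)" using init by (simp add: breakpoints_def)
  have range: "x i \<in> {0..real_of_int (rail I)}" if im: "i \<le> m" for i
  proof (cases i)
    case 0
    then show ?thesis using init valid by (simp add: valid_instance_def)
  next
    case (Suc i')
    then obtain k where "k \<le> num I" "i = 2*k+1 \<or> i = 2*k+2" using parity[of i'] im by auto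
    then show ?thesis using dir[of k] ends[of k] by auto
  qed
  \<comment> \<open>The comparison fixes the sign. If the two points coincide, the piece has
    duration zero and either sign fits.\<close>
  define v where "v i = (if even i then (if x i \<le> x (Suc i) then ?s else - ?s)
    else (if x i \<le> x (Suc i) then 1 else - 1))" for i
  have v: "x (Suc i) = x i + v i * (\<tau> (Suc i) - \<tau> i)" if i: "i < m" for i
  proof -
    obtain k where k: "k \<le> num I" "i = 2*k \<or> i = 2*k+1" using parity[OF i] by blast
    from k(2) show ?thesis
    proof
      assume "i = 2*k"
      then show ?thesis using travel[OF k(1)] s by (auto simp: v_def abs_if)
    next
      assume "i = 2*k+1"
      then show ?thesis using dir[OF k(1)] reclaim[OF k(1)] ends[of k] by (auto simp: v_def)
    qed
  qed
  obtain H where H: "\<forall>i\<le>m. H (\<tau> i) = x i" "\<forall>i<m. linear_piece H (\<tau> i) (\<tau> (Suc i)) (v i)"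
    "continuous_on {0..\<tau> m} H" "H ` {0..\<tau> m} \<subseteq> {0..real_of_int (rail I)}"
    using polyline_exists[OF bp v range] by blast
  have re: "reclaim_end I S k = \<tau> (2*k+2)" if "k < num I" for k
    using that start[of k] reclaim[of k] by (simp add: reclaim_end_def lend_def rend_def)
  have le: "\<tau> i \<le> \<tau> j" if "i \<le> j" "j \<le> m" for i j
    using breakpoints_mono[OF bp that] .
  have "x m = 0" using dir[of "num I"] by (auto simp: m_def lend_def rend_def)
  then have H0: "H 0 = 0" "H (\<tau> m) = 0" using H(1) init by (metis le0, simp)
  have slopes: "\<exists>w. linear_piece H (\<tau> i) (\<tau> (Suc i)) w \<and> (w \<in> {0, ?s, - ?s} \<or>
      w \<in> {1, - 1} \<and> (\<exists>j<num I. S j \<le> \<tau> i \<and> \<tau> (Suc i) \<le> reclaim_end I S j))"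
    if i: "i < m" for i
  proof -
    obtain k where k: "k \<le> num I" "i = 2*k \<or> i = 2*k+1" using parity[OF i] by blast
    consider "i = 2*k" | "i = 2*k+1" "k < num I" | "i = 2*k+1" "k = num I" using k by force
    then show ?thesis
    proof cases
      case 1
      then have "v i \<in> {0, ?s, - ?s}" by (simp add: v_def)
      then show ?thesis using H(2) i by blast
    next
      case 2
      then have "v i \<in> {1, - 1}" by (simp add: v_def)
      moreover have "S k \<le> \<tau> i" "\<tau> (Suc i) \<le> reclaim_end I S k"
        using 2 start[of k] re[of k] by auto
      ultimately show ?thesis using H(2) i 2 by blast
    next
      \<comment> \<open>Here \<open>v i\<close> is 1 or -1 without a real stockpile to justify it,
        but the piece has length zero, so slope 0 describes it as well.\<close>
      case 3
      then have "\<tau> (Suc i) = \<tau> i"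
        using reclaim[of k] by (simp add: lend_def rend_def)
      then have "linear_piece H (\<tau> i) (\<tau> (Suc i)) 0" by (simp add: linear_piece_def)
      then show ?thesis by blast
    qed
  qed
  have piles: "0 \<le> S j" "reclaim_end I S j \<le> \<tau> m"
    "(\<forall>t\<in>{S j..reclaim_end I S j}. H t = lpos I j + (t - S j)) \<or>
     (\<forall>t\<in>{S j..reclaim_end I S j}. H t = rpos I j - (t - S j))"
    if j: "j < num I" for j
  proof -
    have S: "S j = \<tau> (2*j+1)" and m: "2*j+1 < m" using start j by (auto simp: m_def)
    show "0 \<le> S j" using le[of 0 "2*j+1"] init S m by simp
    show "reclaim_end I S j \<le> \<tau> m" using le[of "2*j+2" m] re[OF j] m by simp
    have lp: "linear_piece H (S j) (reclaim_end I S j) (v (2*j+1))" and HS: "H (S j) = x (2*j+1)"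
      using H m S re[OF j] by auto
    have "\<forall>t\<in>{S j..reclaim_end I S j}. H t = x (2*j+1) + v (2*j+1) * (t - S j)"
      using lp unfolding linear_piece_def HS .
    \<comment> \<open>Positive width makes the two ends distinct, so the starting end determines the
      sign of the slope.\<close>
    moreover have "x (2*j+1) = lpos I j \<and> v (2*j+1) = 1 \<or> x (2*j+1) = rpos I j \<and> v (2*j+1) = - 1"
      using dir[of j] j pile[OF j] by (auto simp: v_def lend_def rend_def)
    ultimately show "(\<forall>t\<in>{S j..reclaim_end I S j}. H t = lpos I j + (t - S j)) \<or>
      (\<forall>t\<in>{S j..reclaim_end I S j}. H t = rpos I j - (t - S j))" by auto
  qed
  have order: "reclaim_end I S j \<le> S (Suc j)" if "Suc j < num I" for j
    using that le[of "2*j+2" "2 * Suc j + 1"] re[of j] start[of "Suc j"] by (simp add: m_def)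
  have "0 \<le> \<tau> m" using le[of 0 m] init by simp
  then have "schedule I (\<tau> m) H S"
    unfolding schedule_def using H0 H(3,4) bp slopes piles order by blast
  then show ?thesis using bp H(1,2) by blast
qed


section \<open>Execution of while programs\<close>

fun loop_free :: "com \<Rightarrow> bool" where
  "loop_free (Seq c1 c2) \<longleftrightarrow> loop_free c1 \<and> loop_free c2"
| "loop_free (Cond b c1 c2) \<longleftrightarrow> loop_free c1 \<and> loop_free c2"
| "loop_free (While b c) \<longleftrightarrow> False"
| "loop_free _ \<longleftrightarrow> True"

fun run :: "com \<Rightarrow> state \<Rightarrow> state" where
  "run (IAssign x e) \<sigma> = \<sigma>\<lparr>ivar := (ivar \<sigma>)(x := ival e \<sigma>)\<rparr>"
| "run (RAssign x e) \<sigma> = \<sigma>\<lparr>rvar := (rvar \<sigma>)(x := rval e \<sigma>)\<rparr>"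
| "run (RPut A k e) \<sigma> = \<sigma>\<lparr>arr := (arr \<sigma>)(A := (arr \<sigma> A)(ival k \<sigma> := rval e \<sigma>))\<rparr>"
| "run (Seq c1 c2) \<sigma> = run c2 (run c1 \<sigma>)"
| "run (Cond b c1 c2) \<sigma> = (if bval b \<sigma> then run c1 \<sigma> else run c2 \<sigma>)"
| "run _ \<sigma> = \<sigma>"

text \<open>A conditional is charged its dearer branch, so the bound does not depend on the
  state.\<close>

fun cost_bound :: "com \<Rightarrow> nat" where
  "cost_bound (IAssign x e) = icost e + 1"
| "cost_bound (RAssign x e) = rcost e + 1"
| "cost_bound (RPut A k e) = icost k + rcost e + 1"
| "cost_bound (Seq c1 c2) = cost_bound c1 + cost_bound c2"
| "cost_bound (Cond b c1 c2) = bcost b + max (cost_bound c1) (cost_bound c2) + 1"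
| "cost_bound _ = 1"

lemma exec_run:
  "loop_free c \<Longrightarrow> \<exists>t\<le>cost_bound c. exec c \<sigma> t (run c \<sigma>)"
proof (induction c arbitrary: \<sigma>)
  case (Seq c1 c2)
  then obtain t1 t2 where "t1 \<le> cost_bound c1" "exec c1 \<sigma> t1 (run c1 \<sigma>)"
    "t2 \<le> cost_bound c2" "exec c2 (run c1 \<sigma>) t2 (run c2 (run c1 \<sigma>))" by (metis loop_free.simps(1))
  then show ?case by (intro exI[of _ "t1 + t2"]) (auto intro: exec.Seq)
next
  case (Cond b c1 c2)
  then obtain t1 t2 where "t1 \<le> cost_bound c1" "exec c1 \<sigma> t1 (run c1 \<sigma>)"
    "t2 \<le> cost_bound c2" "exec c2 \<sigma> t2 (run c2 \<sigma>)" by (metis loop_free.simps(2))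
  then show ?case
    by (intro exI[of _ "bcost b + (if bval b \<sigma> then t1 else t2) + 1"])
       (auto intro: exec.CondTrue[simplified] exec.CondFalse[simplified])
next
  case Skip
  show ?case using exec.Skip by auto
next
  case (IAssign x e)
  show ?case using exec.IAssign by auto
next
  case (RAssign x e)
  show ?case using exec.RAssign by auto
next
  case (RPut A k e)
  show ?case using exec.RPut by auto
qed simp

text \<open>The measure drops in every round, so at most \<open>f \<sigma>\<close> rounds occur,
  each paying for the test, the body and one unit; the last summands pay for the failing
  test.\<close>

lemma exec_while:
  assumes "loop_free c"
    and "\<And>\<sigma>. P \<sigma> \<Longrightarrow> bval b \<sigma> \<Longrightarrow> P (run c \<sigma>) \<and> f (run c \<sigma>) < f \<sigma>"
    and "P \<sigma>"
  shows "\<exists>t \<sigma>'. exec (While b c) \<sigma> t \<sigma>' \<and>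
    t \<le> (f \<sigma> :: nat) * (bcost b + cost_bound c + 1) + bcost b + 1 \<and> P \<sigma>' \<and> \<not> bval b \<sigma>'"
  using assms(3)
proof (induction "f \<sigma>" arbitrary: \<sigma> rule: less_induct)
  case less
  let ?K = "bcost b + cost_bound c + 1"
  show ?case
  proof (cases "bval b \<sigma>")
    case False
    then show ?thesis using less.prems exec.WhileFalse by (fastforce)
  next
    case True
    note body = assms(2)[OF less.prems True]
    obtain t1 where t1: "t1 \<le> cost_bound c" "exec c \<sigma> t1 (run c \<sigma>)"
      using exec_run[OF assms(1)] by blast
    obtain t2 \<sigma>' where t2: "exec (While b c) (run c \<sigma>) t2 \<sigma>'" "P \<sigma>'" "\<not> bval b \<sigma>'"
      "t2 \<le> f (run c \<sigma>) * ?K + bcost b + 1"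
      using less.hyps[of "run c \<sigma>"] body by blast
    \<comment> \<open>The strict decrease frees one multiple of \<open>?K\<close> for the current
      round.\<close>
    have "Suc (f (run c \<sigma>)) * ?K \<le> f \<sigma> * ?K"
      using body by (intro mult_le_mono1) simp
    then have "bcost b + t1 + t2 + 1 \<le> f \<sigma> * ?K + bcost b + 1" using t1 t2(4) by simp
    then show ?thesis using exec.WhileTrue[OF True t1(2) t2(1)] t2 by blast
  qed
qed


section \<open>The program\<close>

text \<open>A conditional whose branches the simplifier enters.\<close>

definition pick :: "bool \<Rightarrow> real \<Rightarrow> real \<Rightarrow> real" where
  "pick P u v = (if P then u else v)"

definition select :: "name \<Rightarrow> bexp \<Rightarrow> rexp \<Rightarrow> rexp \<Rightarrow> com" where
  "select x b e1 e2 = Cond b (RAssign x e1) (RAssign x e2)"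

lemma loop_free_select [simp]: "loop_free (select x b e1 e2)"
  by (simp add: select_def)

lemma run_select [simp]:
  "run (select x b e1 e2) \<sigma> =
     \<sigma>\<lparr>rvar := (rvar \<sigma>)(x := pick (bval b \<sigma>) (rval e1 \<sigma>) (rval e2 \<sigma>))\<rparr>"
  by (simp add: select_def pick_def)

definition distance :: "name \<Rightarrow> rexp \<Rightarrow> rexp \<Rightarrow> com" where
  "distance x e1 e2 = select x (RLess e1 e2) (ROp Minus e2 e1) (ROp Minus e1 e2)"

lemma loop_free_distance [simp]: "loop_free (distance x e1 e2)"
  by (simp add: distance_def)

lemma run_distance [simp]:
  "run (distance x e1 e2) \<sigma> = \<sigma>\<lparr>rvar := (rvar \<sigma>)(x := \<bar>rval e1 \<sigma> - rval e2 \<sigma>\<bar>)\<rparr>"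
  by (auto simp: distance_def pick_def)

definition minimum :: "name \<Rightarrow> rexp \<Rightarrow> rexp \<Rightarrow> com" where
  "minimum x e1 e2 = select x (RLess e1 e2) e1 e2"

lemma loop_free_minimum [simp]: "loop_free (minimum x e1 e2)"
  by (simp add: minimum_def)

lemma run_minimum [simp]:
  "run (minimum x e1 e2) \<sigma> = \<sigma>\<lparr>rvar := (rvar \<sigma>)(x := min (rval e1 \<sigma>) (rval e2 \<sigma>))\<rparr>"
  by (auto simp: minimum_def pick_def min_def)

abbreviation j_exp :: iexp where "j_exp \<equiv> IVar ''j''"

text \<open>Array \<open>A\<close> (\<open>B\<close>) at index \<open>j\<close> is to hold the remaining time once stockpile \<open>j\<close> has been
  reclaimed rightwards (leftwards).\<close>

definition tabulate :: "name \<Rightarrow> name \<Rightarrow> com" where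
  "tabulate X side =
     Seq (RAssign ''q'' (RGet side (IPred j_exp)))
    (Seq (distance ''a'' (RVar ''q'') (RGet ''l'' j_exp))
    (Seq (distance ''b'' (RVar ''q'') (RGet ''r'' j_exp))
    (Seq (RAssign ''a'' (ROp Plus (ROp Divide (RVar ''a'') (RVar ''s'')) (RGet ''A'' j_exp)))
    (Seq (RAssign ''b'' (ROp Plus (ROp Divide (RVar ''b'') (RVar ''s'')) (RGet ''B'' j_exp)))
    (Seq (minimum ''a'' (RVar ''a'') (RVar ''b''))
         (RPut X (IPred j_exp)
           (ROp Plus (RVar ''a'') (ROp Minus (RGet ''r'' j_exp) (RGet ''l'' j_exp)))))))))"

text \<open>Rightward reclaiming ends at the right end, hence \<open>''A''\<close> goes with
  \<open>''r''\<close>. Both tabulations read table entries at \<open>j\<close> and write at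
  \<open>j - 1\<close>, so neither disturbs the other.\<close>

definition backward_body :: com where
  "backward_body =
     Seq (tabulate ''A'' ''r'') (Seq (tabulate ''B'' ''l'') (IAssign ''j'' (IPred j_exp)))"

definition init_forward :: com where
  "init_forward =
     Seq (IAssign ''j'' (IConst 0)) (Seq (IAssign ''m'' (IConst 0))
    (Seq (RAssign ''p'' (RConst 0)) (Seq (RAssign ''t'' (RConst 0))
    (Seq (RPut ''time'' (IConst 0) (RConst 0)) (RPut ''pos'' (IConst 0) (RConst 0))))))"

definition emit :: com where
  "emit =
     Seq (IAssign ''m'' (ISuc (IVar ''m'')))
    (Seq (RPut ''time'' (IVar ''m'') (RVar ''t'')) (RPut ''pos'' (IVar ''m'') (RVar ''p'')))"

text \<open>The test \<open>rightwards\<close> is evaluated three times, but nothing it reads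
  changes in between, so the choice is consistent. The width is common to both directions and is
  left out of the comparison.\<close>

definition forward_body :: com where
  "forward_body =
    (let rightwards = RLess (ROp Plus (RVar ''a'') (RGet ''A'' j_exp))
                            (ROp Plus (RVar ''b'') (RGet ''B'' j_exp)) in
     Seq (distance ''a'' (RVar ''p'') (RGet ''l'' j_exp))
    (Seq (distance ''b'' (RVar ''p'') (RGet ''r'' j_exp))
    (Seq (RAssign ''a'' (ROp Divide (RVar ''a'') (RVar ''s'')))
    (Seq (RAssign ''b'' (ROp Divide (RVar ''b'') (RVar ''s'')))
    (Seq (select ''d'' rightwards (RVar ''a'') (RVar ''b''))
    (Seq (select ''p'' rightwards (RGet ''l'' j_exp) (RGet ''r'' j_exp))
    (Seq (RAssign ''t'' (ROp Plus (RVar ''t'') (RVar ''d'')))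
    (Seq emit
    (Seq (RPut ''start'' j_exp (RVar ''t''))
    (Seq (select ''p'' rightwards (RGet ''r'' j_exp) (RGet ''l'' j_exp))
    (Seq (RAssign ''t'' (ROp Plus (RVar ''t'') (ROp Minus (RGet ''r'' j_exp) (RGet ''l'' j_exp))))
    (Seq emit
         (IAssign ''j'' (ISuc j_exp))))))))))))))"

abbreviation backward_guard :: bexp where "backward_guard \<equiv> ILess (IConst 0) j_exp"

text \<open>The successor includes index \<open>n\<close>: that last round is the return trip to
  0.\<close>

abbreviation forward_guard :: bexp where "forward_guard \<equiv> ILess j_exp (ISuc (IVar ''n''))"

definition optimal_tour :: com where
  "optimal_tour =
     Seq (IAssign ''j'' (IVar ''n''))
    (Seq (While backward_guard backward_body)
    (Seq init_forward
    (Seq (While forward_guard forward_body)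
         (RAssign ''C'' (RVar ''t'')))))"

section \<open>Loop invariants\<close>

definition input_intact :: "reclaim_instance \<Rightarrow> state \<Rightarrow> bool" where
  "input_intact I \<sigma> \<longleftrightarrow> ivar \<sigma> ''n'' = num I \<and> rvar \<sigma> ''s'' = speed I \<and>
     arr \<sigma> ''l'' = lend I \<and> arr \<sigma> ''r'' = rend I"

definition tabulated :: "reclaim_instance \<Rightarrow> nat \<Rightarrow> state \<Rightarrow> bool" where
  "tabulated I j \<sigma> \<longleftrightarrow> (\<forall>i. j \<le> i \<longrightarrow> i \<le> num I \<longrightarrow>
     arr \<sigma> ''A'' i = remaining_time (speed I) (drop (Suc i) (piles I)) (rend I i) \<and>
     arr \<sigma> ''B'' i = remaining_time (speed I) (drop (Suc i) (piles I)) (lend I i))"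

definition backward_inv :: "reclaim_instance \<Rightarrow> state \<Rightarrow> bool" where
  "backward_inv I \<sigma> \<longleftrightarrow> input_intact I \<sigma> \<and> ivar \<sigma> ''j'' \<le> num I \<and> tabulated I (ivar \<sigma> ''j'') \<sigma>"

lemma run_tabulate:
  shows "ivar (run (tabulate X side) \<sigma>) = ivar \<sigma>"
    and "rvar (run (tabulate X side) \<sigma>) ''s'' = rvar \<sigma> ''s''"
    and "arr (run (tabulate X side) \<sigma>) = (let j = ivar \<sigma> ''j''; q = arr \<sigma> side (j - 1) in
      (arr \<sigma>)(X := (arr \<sigma> X)(j - 1 :=
        min (\<bar>q - arr \<sigma> ''l'' j\<bar> / rvar \<sigma> ''s'' + arr \<sigma> ''A'' j)
            (\<bar>q - arr \<sigma> ''r'' j\<bar> / rvar \<sigma> ''s'' + arr \<sigma> ''B'' j)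
          + (arr \<sigma> ''r'' j - arr \<sigma> ''l'' j))))"
  by (simp_all add: tabulate_def Let_def)

text \<open>The entries written are the recursion for the suffix after a stockpile, evaluated at the
  two ends of that stockpile; the minimum draws on the entries of the next one, already
  correct.\<close>

lemma backward_step:
  assumes inv: "backward_inv I \<sigma>" and "bval backward_guard \<sigma>"
  shows "backward_inv I (run backward_body \<sigma>) \<and>
    ivar (run backward_body \<sigma>) ''j'' < ivar \<sigma> ''j''"
proof -
  obtain j where j: "ivar \<sigma> ''j'' = Suc j" using assms(2) by (auto dest: gr0_implies_Suc)
  let ?\<sigma> = "run backward_body \<sigma>"
  let ?G = "\<lambda>k. remaining_time (speed I) (drop k (piles I))"
  have inv': "input_intact I \<sigma>" "Suc j \<le> num I" "tabulated I (Suc j) \<sigma>"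
    using inv j by (auto simp: backward_inv_def)
  have AB: "arr \<sigma> ''A'' (Suc j) = ?G (Suc (Suc j)) (rend I (Suc j))"
    "arr \<sigma> ''B'' (Suc j) = ?G (Suc (Suc j)) (lend I (Suc j))"
    using inv'(2,3) by (auto simp: tabulated_def)
  have "input_intact I ?\<sigma>" and "ivar ?\<sigma> ''j'' = j"
    and "arr ?\<sigma> ''A'' = (arr \<sigma> ''A'')(j := ?G (Suc j) (rend I j))"
    and "arr ?\<sigma> ''B'' = (arr \<sigma> ''B'')(j := ?G (Suc j) (lend I j))"
    using inv'(1) j AB remaining_time_drop[OF inv'(2)]
    by (simp_all add: backward_body_def run_tabulate Let_def input_intact_def)
  moreover from this have "tabulated I j ?\<sigma>"
    using inv'(3) by (auto simp: tabulated_def)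
  ultimately show ?thesis using inv'(2) j by (simp add: backward_inv_def)
qed

text \<open>The last conjunct is a conserved quantity: elapsed time plus least remaining time stays
  equal to the optimal value.\<close>

definition forward_inv :: "reclaim_instance \<Rightarrow> state \<Rightarrow> bool" where
  "forward_inv I \<sigma> \<longleftrightarrow> (let j = ivar \<sigma> ''j''; \<tau> = arr \<sigma> ''time''; x = arr \<sigma> ''pos'' in
     input_intact I \<sigma> \<and> tabulated I 0 \<sigma> \<and> j \<le> Suc (num I) \<and> ivar \<sigma> ''m'' = 2 * j \<and>
     rvar \<sigma> ''p'' = x (2 * j) \<and> rvar \<sigma> ''t'' = \<tau> (2 * j) \<and>
     tour I j \<tau> x (arr \<sigma> ''start'') \<and>
     \<tau> (2 * j) + remaining_time (speed I) (drop j (piles I)) (x (2 * j)) =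
       remaining_time (speed I) (piles I) 0)"

text \<open>Only points \<open>2*j+1\<close> and \<open>2*j+2\<close> are new, while the steps
  before \<open>j\<close> read indices up to \<open>2*j\<close>. The updates use \<open>Suc\<close>
  to match two increments of \<open>''m''\<close>.\<close>

lemma tour_Suc:
  assumes "tour I j \<tau> x S"
    and "a = lend I j \<and> b = rend I j \<or> a = rend I j \<and> b = lend I j"
    and "t = \<tau> (2*j) + \<bar>x (2*j) - a\<bar> / speed I" and "u = t + (rend I j - lend I j)"
  shows "tour I (Suc j) (\<tau>(Suc (2*j) := t, Suc (Suc (2*j)) := u))
    (x(Suc (2*j) := a, Suc (Suc (2*j)) := b)) (S(j := t))"
proof -
  define \<tau>' where "\<tau>' = \<tau>(Suc (2*j) := t, Suc (Suc (2*j)) := u)"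
  define x' where "x' = x(Suc (2*j) := a, Suc (Suc (2*j)) := b)"
  have old: "\<tau>' i = \<tau> i" "x' i = x i" if "i \<le> 2*j" for i
    using that by (simp_all add: \<tau>'_def x'_def)
  have new: "\<tau>' (2*j+1) = t" "\<tau>' (2*j+2) = u" "x' (2*j+1) = a" "x' (2*j+2) = b"
    by (simp_all add: \<tau>'_def x'_def)
  have "(x' (2*k+1) = lend I k \<and> x' (2*k+2) = rend I k \<or>
         x' (2*k+1) = rend I k \<and> x' (2*k+2) = lend I k) \<and>
        \<tau>' (2*k+1) = \<tau>' (2*k) + \<bar>x' (2*k) - x' (2*k+1)\<bar> / speed I \<and>
        \<tau>' (2*k+2) = \<tau>' (2*k+1) + (rend I k - lend I k) \<and>
        (S(j := t)) k = \<tau>' (2*k+1)" if "k < Suc j" for k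
  proof (cases "k = j")
    case True
    show ?thesis unfolding True new using old[of "2*j"] assms(2-4) by simp
  next
    case False
    with that have "k < j" by simp
    then have "2*k \<le> 2*j" "2*k+1 \<le> 2*j" "2*k+2 \<le> 2*j" by simp_all
    note eqs = this[THEN old(1)] this[THEN old(2)]
    show ?thesis unfolding eqs using assms(1) \<open>k < j\<close> by (simp add: tour_def)
  qed
  moreover have "\<tau>' 0 = 0" "x' 0 = 0" using assms(1) old[of 0] by (simp_all add: tour_def)
  ultimately show ?thesis unfolding tour_def \<tau>'_def[symmetric] x'_def[symmetric] by blast
qed

lemma forward_step:
  assumes inv: "forward_inv I \<sigma>" and "bval forward_guard \<sigma>"
  shows "forward_inv I (run forward_body \<sigma>) \<and>
    Suc (num I) - ivar (run forward_body \<sigma>) ''j'' < Suc (num I) - ivar \<sigma> ''j''"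
proof -
  define j where "j = ivar \<sigma> ''j''"
  define \<tau> where "\<tau> = arr \<sigma> ''time''"
  define x where "x = arr \<sigma> ''pos''"
  let ?\<sigma> = "run forward_body \<sigma>" and ?s = "speed I"
  let ?G = "\<lambda>k. remaining_time (speed I) (drop k (piles I))"
  have intact: "input_intact I \<sigma>" and tab: "tabulated I 0 \<sigma>" and m: "ivar \<sigma> ''m'' = 2 * j"
    and p: "rvar \<sigma> ''p'' = x (2 * j)" and t: "rvar \<sigma> ''t'' = \<tau> (2 * j)"
    and tour: "tour I j \<tau> x (arr \<sigma> ''start'')"
    and total: "\<tau> (2 * j) + ?G j (x (2 * j)) = ?G 0 0"
    using inv by (auto simp: forward_inv_def Let_def j_def \<tau>_def x_def)
  have j: "j \<le> num I"
    using assms(2) intact by (simp add: j_def input_intact_def)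
  have AB: "arr \<sigma> ''A'' j = ?G (Suc j) (rend I j)" "arr \<sigma> ''B'' j = ?G (Suc j) (lend I j)"
    using tab j by (auto simp: tabulated_def)
  \<comment> \<open>The machine's test in terms of the recursion. Ties go leftwards, where both
    branches attain the minimum.\<close>
  define rw where "rw \<longleftrightarrow> \<bar>x (2*j) - lend I j\<bar> / ?s + ?G (Suc j) (rend I j)
     < \<bar>x (2*j) - rend I j\<bar> / ?s + ?G (Suc j) (lend I j)"
  define a where "a = (if rw then lend I j else rend I j)"
  define b where "b = (if rw then rend I j else lend I j)"
  define t1 where "t1 = \<tau> (2*j) + \<bar>x (2*j) - a\<bar> / ?s"
  define t2 where "t2 = t1 + (rend I j - lend I j)"
  have post: "input_intact I ?\<sigma>" "ivar ?\<sigma> ''j'' = Suc j" "ivar ?\<sigma> ''m'' = Suc (Suc (2 * j))"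
    "arr ?\<sigma> ''A'' = arr \<sigma> ''A''" "arr ?\<sigma> ''B'' = arr \<sigma> ''B''"
    "rvar ?\<sigma> ''p'' = b" "rvar ?\<sigma> ''t'' = t2"
    "arr ?\<sigma> ''time'' = \<tau>(Suc (2*j) := t1, Suc (Suc (2*j)) := t2)"
    "arr ?\<sigma> ''pos'' = x(Suc (2*j) := a, Suc (Suc (2*j)) := b)"
    "arr ?\<sigma> ''start'' = (arr \<sigma> ''start'')(j := t1)"
    using intact m p t AB
    by (simp_all add: forward_body_def emit_def Let_def input_intact_def j_def[symmetric]
        \<tau>_def[symmetric] x_def[symmetric] rw_def[symmetric] pick_def a_def b_def t1_def t2_def)
  have "tabulated I 0 ?\<sigma>" using tab by (simp add: tabulated_def post)
  \<comment> \<open>The chosen branch attains the minimum, so elapsed time grows by exactly what the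
    remaining time loses.\<close>
  moreover have "t2 + ?G (Suc j) b = ?G 0 0"
    using total remaining_time_drop[OF j, of ?s "x (2*j)"]
    by (auto simp: t2_def t1_def a_def b_def rw_def min_def split: if_splits)
  moreover have "tour I (Suc j) (arr ?\<sigma> ''time'') (arr ?\<sigma> ''pos'') (arr ?\<sigma> ''start'')"
    unfolding post by (rule tour_Suc[OF tour _ t1_def t2_def]) (simp add: a_def b_def)
  ultimately show ?thesis
    using j post by (simp add: forward_inv_def Let_def j_def[symmetric])
qed

section \<open>Correctness, optimality and cost of the whole program\<close>

text \<open>The makespan equals the value of the recursion from 0, which no schedule undercuts. In
  the cost, 6 is two assignments of cost 2 and one unit for each of the two failing loop
  tests.\<close>

lemma optimal_tour_exec:
  assumes "valid_instance I"
  shows "\<exists>t \<sigma>. exec optimal_tour (input_state I) t \<sigma> \<and>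
    t \<le> num I * (bcost backward_guard + cost_bound backward_body + 1)
      + Suc (num I) * (bcost forward_guard + cost_bound forward_body + 1)
      + (bcost backward_guard + bcost forward_guard + cost_bound init_forward + 6) \<and>
    (\<exists>C H S. output_schedule \<sigma> C H S \<and> optimal_schedule I C H S)"
proof -
  define \<sigma>0 where "\<sigma>0 = run (IAssign ''j'' (IVar ''n'')) (input_state I)"
  have exec0: "exec (IAssign ''j'' (IVar ''n'')) (input_state I) 2 \<sigma>0"
    using exec.IAssign[of "''j''" "IVar ''n''"] by (simp add: \<sigma>0_def numeral_2_eq_2)
  \<comment> \<open>The table entries at \<open>num I\<close> must be the time to return from 0 to
    0, so zero-initialised arrays already satisfy the invariant.\<close>
  have j0: "ivar \<sigma>0 ''j'' = num I" and inv0: "backward_inv I \<sigma>0"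
    by (auto simp: \<sigma>0_def input_state_def backward_inv_def input_intact_def tabulated_def
        lend_def rend_def)
  have "loop_free backward_body" by (simp add: backward_body_def tabulate_def)
  from exec_while[of _ "backward_inv I" _ "\<lambda>\<sigma>. ivar \<sigma> ''j''", OF this backward_step inv0]
  obtain t1 \<sigma>1 where exec1: "exec (While backward_guard backward_body) \<sigma>0 t1 \<sigma>1"
    and t1: "t1 \<le> num I * (bcost backward_guard + cost_bound backward_body + 1)
       + bcost backward_guard + 1"
    and inv1: "backward_inv I \<sigma>1" "\<not> bval backward_guard \<sigma>1"
    unfolding j0 by blast
  define \<sigma>2 where "\<sigma>2 = run init_forward \<sigma>1"
  have "loop_free init_forward" by (simp add: init_forward_def)
  from exec_run[OF this] obtain t2 where t2: "t2 \<le> cost_bound init_forward"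
    and exec2: "exec init_forward \<sigma>1 t2 \<sigma>2" unfolding \<sigma>2_def by blast
  have j2: "ivar \<sigma>2 ''j'' = 0" and inv2: "forward_inv I \<sigma>2"
    using inv1 by (auto simp: \<sigma>2_def init_forward_def backward_inv_def forward_inv_def
        input_intact_def tabulated_def tour_def)
  have "loop_free forward_body" by (simp add: forward_body_def emit_def Let_def)
  from exec_while[of _ "forward_inv I" _ "\<lambda>\<sigma>. Suc (num I) - ivar \<sigma> ''j''",
      OF this forward_step inv2]
  obtain t3 \<sigma>3 where exec3: "exec (While forward_guard forward_body) \<sigma>2 t3 \<sigma>3"
    and t3: "t3 \<le> Suc (num I) * (bcost forward_guard + cost_bound forward_body + 1)
       + bcost forward_guard + 1"
    and inv3: "forward_inv I \<sigma>3" "\<not> bval forward_guard \<sigma>3"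
    unfolding j2 diff_zero by blast
  define \<sigma>4 where "\<sigma>4 = run (RAssign ''C'' (RVar ''t'')) \<sigma>3"
  have exec4: "exec (RAssign ''C'' (RVar ''t'')) \<sigma>3 2 \<sigma>4"
    using exec.RAssign[of "''C''" "RVar ''t''"] by (simp add: \<sigma>4_def numeral_2_eq_2)
  let ?m = "2 * Suc (num I)"
  define \<tau> where "\<tau> = arr \<sigma>4 ''time''"
  define x where "x = arr \<sigma>4 ''pos''"
  define S where "S = arr \<sigma>4 ''start''"
  have j3: "ivar \<sigma>3 ''j'' = Suc (num I)"
    using inv3 by (auto simp: forward_inv_def input_intact_def Let_def)
  have m: "ivar \<sigma>4 ''m'' = ?m" and C: "rvar \<sigma>4 ''C'' = \<tau> ?m"
    and tour: "tour I (Suc (num I)) \<tau> x S"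
    and total: "\<tau> ?m + remaining_time (speed I) [] (x ?m) = remaining_time (speed I) (piles I) 0"
    using inv3(1) j3 by (auto simp: forward_inv_def Let_def \<sigma>4_def \<tau>_def x_def S_def)
  \<comment> \<open>The final point is an end of the fictitious stockpile, so no time remains in the
    conserved total.\<close>
  have "x ?m = 0" using tour by (auto simp: tour_def lend_def rend_def)
  with total have opt: "\<tau> ?m = remaining_time (speed I) (piles I) 0" by simp
  obtain H where H: "breakpoints ?m \<tau> (\<tau> ?m)" "\<forall>i\<le>?m. H (\<tau> i) = x i"
    "\<forall>i<?m. \<exists>v. linear_piece H (\<tau> i) (\<tau> (Suc i)) v" "schedule I (\<tau> ?m) H S"
    using tour_schedule[OF assms tour] by blast
  have "optimal_schedule I (\<tau> ?m) H S"
    using H(4) schedule_lower_bound[OF _ assms] opt by (auto simp: optimal_schedule_def)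
  moreover have "output_schedule \<sigma>4 (\<tau> ?m) H S"
    using H(1-3) m C by (simp add: output_schedule_def Let_def \<tau>_def x_def S_def)
  moreover have "exec optimal_tour (input_state I) (2 + (t1 + (t2 + (t3 + 2)))) \<sigma>4"
    unfolding optimal_tour_def
    by (rule exec.Seq[OF exec0 exec.Seq[OF exec1 exec.Seq[OF exec2 exec.Seq[OF exec3 exec4]]]])
  moreover note t1 t2 t3
  ultimately show ?thesis
    by (intro exI[of _ "2 + (t1 + (t2 + (t3 + 2)))"] exI[of _ \<sigma>4] conjI) (linarith | blast)+
qed

theorem theorem10:
  "\<exists>prog T. computes_optimal_schedule_within prog T \<and>
     (\<lambda>n. real (T n)) \<in> O(\<lambda>n. real n)"
proof -
  define K1 where "K1 = bcost backward_guard + cost_bound backward_body + 1"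
  define K2 where "K2 = bcost forward_guard + cost_bound forward_body + 1"
  define K0 where "K0 = bcost backward_guard + bcost forward_guard + cost_bound init_forward + 6"
  define T where "T n = n * K1 + Suc n * K2 + K0" for n
  have "computes_optimal_schedule_within optimal_tour T"
    unfolding computes_optimal_schedule_within_def T_def K1_def K2_def K0_def
    using optimal_tour_exec by blast
  moreover have "(\<lambda>n. real (T n)) \<in> O(\<lambda>n. real n)"
  \<comment> \<open>For \<open>1 \<le> n\<close>, \<open>Suc n \<le> 2 * n\<close> and
    \<open>K0 \<le> K0 * n\<close> give the constant. At \<open>n = 0\<close> the value of
    \<open>T\<close> is positive, so the linear bound holds only eventually.\<close>
  proof (rule bigoI[of _ "real (K1 + 2 * K2 + K0)"])
    have "T n \<le> (K1 + 2 * K2 + K0) * n" if "1 \<le> n" for n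
    proof -
      have "Suc n * K2 \<le> (2 * n) * K2" and "K0 \<le> K0 * n"
        using that by (intro mult_le_mono1, simp, simp)
      then have "T n \<le> n * K1 + (2 * n) * K2 + K0 * n"
        unfolding T_def by (intro add_mono order_refl)
      then show ?thesis by (simp add: algebra_simps)
    qed
    then show "\<forall>\<^sub>F n in sequentially. norm (real (T n)) \<le> real (K1 + 2 * K2 + K0) * norm (real n)"
      by (intro eventually_sequentiallyI[of 1])
         (simp del: of_nat_add of_nat_mult add: of_nat_mult[symmetric])
  qed
  ultimately show ?thesis by blast
qed

end
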